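(* Let $\mathcal F$ be a flag of a finite abelian group or of a finite field extension, of degree $n$. Then for every corner $(i,j)$ of $T_{\mathcal F}$ we have $T_{\mathcal F}(i,j)\ge i+j$.
   Context: Let $[n]=\{0,\dots,n-1\}$. A flag of a finite abelian group $G$ of order $n$ (written multiplicatively) is a chain of subsets $\{1\}=F_0\subset\cdots\subset F_{n-1}=G$ with $|F_i|=i+1$; a flag of a degree $n$ field extension $L/K$ is a chain of $K$-subspaces $K=F_0\subset\cdots\subset F_{n-1}=L$ with $\dim_KF_i=i+1$. The flag type of a flag is $T_{\mathcal F}:[n]\times[n]\to[n]$, $T_{\mathcal F}(i,j)=\min\{k: F_iF_j\subseteq F_k\}$, where $F_iF_j$ is the set of products (groups) or the $K$-span of products (fields). For $0<i,j<n$, $(i,j)$ is a corner of $T_{\mathcal F}$ if $T_{\mathcal F}(i-1,j)<T_{\mathcal F}(i,j)$ and $T_{\mathcal F}(i,j-1)<T_{\mathcal F}(i,j)$. *)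

theory Defs
  imports "HOL-Algebra.Embedded_Algebras"
begin

text \<open>
  A chain \<open>F\<^sub>0 \<subset> \<dots> \<subset> F\<^sub>n\<^sub>-\<^sub>1\<close> is represented by a function
  \<open>F :: nat \<Rightarrow> 'a set\<close>; its values at arguments \<open>\<ge> n\<close> are irrelevant.
  For both kinds of flag, \<open>n\<close> is the degree: the order of the group, respectively
  the degree of the field extension.
\<close>

definition group_flag :: "('a, 'm) monoid_scheme \<Rightarrow> nat \<Rightarrow> (nat \<Rightarrow> 'a set) \<Rightarrow> bool" where
  "group_flag G n F \<longleftrightarrow>
     F 0 = {\<one>\<^bsub>G\<^esub>} \<and> F (n - 1) = carrier G \<and>
     (\<forall>i. Suc i < n \<longrightarrow> F i \<subset> F (Suc i)) \<and>
     (\<forall>i<n. F i \<subseteq> carrier G \<and> card (F i) = i + 1)"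

text \<open>
  In HOL-Algebra a \<open>K\<close>-subspace of \<open>L\<close> is called \<^const>\<open>subalgebra\<close>: despite its name, this
  locale only requires an additive subgroup closed under multiplication by elements of \<open>K\<close>.
\<close>

definition field_flag ::
  "'b set \<Rightarrow> ('b, 'r) ring_scheme \<Rightarrow> nat \<Rightarrow> (nat \<Rightarrow> 'b set) \<Rightarrow> bool" where
  "field_flag K L n F \<longleftrightarrow>
     F 0 = K \<and> F (n - 1) = carrier L \<and>
     (\<forall>i. Suc i < n \<longrightarrow> F i \<subset> F (Suc i)) \<and>
     (\<forall>i<n. subalgebra K (F i) L \<and> ring.dimension L (i + 1) K (F i))"

definition subspace_span :: "'b set \<Rightarrow> ('b, 'r) ring_scheme \<Rightarrow> 'b set \<Rightarrow> 'b set" where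
  "subspace_span K L S = \<Inter> {V. subalgebra K V L \<and> S \<subseteq> V}"

text \<open>On finite sets this is the span of HOL-Algebra, which is only defined for lists.\<close>

lemma (in ring) subspace_span_set:
  assumes "subfield K R" and "set Us \<subseteq> carrier R"
  shows "subspace_span K R (set Us) = Span K Us"
  using Span_subalgebra_minimal[OF assms] by (simp add: subspace_span_def)

text \<open>\<open>P\<close> is the product on subsets, which differs between groups and fields.\<close>

definition flag_type ::
  "('a set \<Rightarrow> 'a set \<Rightarrow> 'a set) \<Rightarrow> nat \<Rightarrow> (nat \<Rightarrow> 'a set) \<Rightarrow> nat \<Rightarrow> nat \<Rightarrow> nat" where
  "flag_type P n F i j = (LEAST k. k < n \<and> P (F i) (F j) \<subseteq> F k)"

definition group_flag_type ::
  "('a, 'm) monoid_scheme \<Rightarrow> nat \<Rightarrow> (nat \<Rightarrow> 'a set) \<Rightarrow> nat \<Rightarrow> nat \<Rightarrow> nat" where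
  "group_flag_type G = flag_type (\<lambda>A B. A <#>\<^bsub>G\<^esub> B)"

definition field_flag_type ::
  "'b set \<Rightarrow> ('b, 'r) ring_scheme \<Rightarrow> nat \<Rightarrow> (nat \<Rightarrow> 'b set) \<Rightarrow> nat \<Rightarrow> nat \<Rightarrow> nat" where
  "field_flag_type K L = flag_type (\<lambda>A B. subspace_span K L (A <#>\<^bsub>L\<^esub> B))"

definition is_corner :: "nat \<Rightarrow> (nat \<Rightarrow> nat \<Rightarrow> nat) \<Rightarrow> nat \<Rightarrow> nat \<Rightarrow> bool" where
  "is_corner n T i j \<longleftrightarrow>
     0 < i \<and> i < n \<and> 0 < j \<and> j < n \<and> T (i - 1) j < T i j \<and> T i (j - 1) < T i j"

end

(*
  At a corner (i,j) of value k+1 there are x in F_i and y in F_j with xy outside F_k, while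
  F_k contains both F_{i-1} F_j and F_i F_{j-1}. In a group this says that xy has only one
  factorisation in F_i F_j, and Scherk's theorem |AB| >= |A| + |B| - 1 for products with a
  uniquely represented element gives k + 2 >= i + j + 1. For fields, after dividing by x, y and
  xy, the coordinate of K + F_k along K = K.1 is a functional that is multiplicative on
  F_i x F_j, and the proof of Scherk's theorem carries over with dimensions in place of
  cardinalities.
*)

theory Submission
  imports Defs
begin

section \<open>Corners of flag types\<close>

text \<open>Turns a corner into inclusions between sets, for an arbitrary product \<open>P\<close>,
  so that groups and fields share the argument. Both neighbouring values are at most
  \<open>k\<close>, and along the chain this places both neighbouring products in
  \<open>F k\<close>.\<close>

lemma corner_flag_typeE:
  assumes corner: "is_corner n (flag_type P n F) i j"
    and chain: "\<And>i. Suc i < n \<Longrightarrow> F i \<subseteq> F (Suc i)"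
    and top: "\<And>i j. i < n \<Longrightarrow> j < n \<Longrightarrow> P (F i) (F j) \<subseteq> F (n - 1)"
  obtains i' j' k where "i = Suc i'" "j = Suc j'" "flag_type P n F i j = Suc k"
    "Suc i' < n" "Suc j' < n" "Suc k < n" "P (F i) (F j) \<subseteq> F (Suc k)" "\<not> P (F i) (F j) \<subseteq> F k"
    "P (F i') (F j) \<subseteq> F k" "P (F i) (F j') \<subseteq> F k"
proof -
  let ?T = "flag_type P n F"
  \<comment> \<open>The index \<open>n - 1\<close> witnesses that the minimum is taken over a
    nonempty set.\<close>
  have T: "?T a b < n \<and> P (F a) (F b) \<subseteq> F (?T a b)" if "a < n" "b < n" for a b
    unfolding flag_type_def
    by (rule LeastI[of "\<lambda>k. k < n \<and> P (F a) (F b) \<subseteq> F k" "n - 1"]) (use that top in auto)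
  have mono: "F a \<subseteq> F b" if "a \<le> b" "b < n" for a b
    using that by (induction b rule: dec_induct) (use chain in \<open>auto dest: Suc_lessD\<close>)
  obtain i' j' where ij: "i = Suc i'" "j = Suc j'" "Suc i' < n" "Suc j' < n"
    using corner unfolding is_corner_def by (metis Suc_pred)
  have less: "?T i' j < ?T i j" "?T i j' < ?T i j"
    using corner ij unfolding is_corner_def by auto
  \<comment> \<open>A corner value exceeds another value, so it is positive.\<close>
  then obtain k where k: "?T i j = Suc k" by (cases "?T i j") auto
  have kn: "Suc k < n" using T[of i j] ij k by auto
  have "\<not> P (F i) (F j) \<subseteq> F k"
    using not_less_Least[of k "\<lambda>k. k < n \<and> P (F i) (F j) \<subseteq> F k"] k kn
    unfolding flag_type_def by auto
  moreover have "P (F i') (F j) \<subseteq> F k" "P (F i) (F j') \<subseteq> F k"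
    using T[of i' j] T[of i j'] mono[of "?T i' j" k] mono[of "?T i j'" k] ij less k kn
    by auto
  moreover have "P (F i) (F j) \<subseteq> F (Suc k)" using T[of i j] ij k by auto
  ultimately show thesis using that ij k kn by blast
qed

section \<open>Scherk's theorem in abelian groups\<close>

text \<open>
  Dyson's transform: \<open>A \<union> aB\<close> and \<open>B \<inter> a\<inverse>A\<close> have the same total size as \<open>A\<close> and \<open>B\<close>,
  their product is still contained in \<open>AB\<close>, and \<open>1\<close> still has only the trivial factorisation.
\<close>

lemma (in comm_group) scherk_unique_one:
  assumes "finite A" "finite B" "finite C" "A \<subseteq> carrier G" "B \<subseteq> carrier G" "\<one> \<in> A" "\<one> \<in> B"
    and "\<And>a b. a \<in> A \<Longrightarrow> b \<in> B \<Longrightarrow> a \<otimes> b \<in> C"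
    and "\<And>a b. a \<in> A \<Longrightarrow> b \<in> B \<Longrightarrow> a \<otimes> b = \<one> \<Longrightarrow> a = \<one> \<and> b = \<one>"
  shows "card A + card B \<le> card C + 1"
  using assms
proof (induction "card B" arbitrary: A B rule: less_induct)
  case less
  show ?case
  proof (cases "\<forall>a\<in>A. \<forall>b\<in>B. a \<otimes> b \<in> A")
    \<comment> \<open>If AB stays in A, each b in B permutes the finite set A by multiplication, so
      ab = 1 for some a in A, and unique factorisation forces b = 1. Hence B is trivial.\<close>
    case True
    have "b = \<one>" if b: "b \<in> B" for b
    proof -
      have "(\<lambda>a. a \<otimes> b) ` A = A"
        using True b less.prems by (intro endo_inj_surj inj_onI) (auto simp: subset_iff)
      then obtain a where "a \<in> A" "a \<otimes> b = \<one>" using \<open>\<one> \<in> A\<close> by force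
      then show ?thesis using less.prems b by blast
    qed
    then have "card B = 1" using \<open>\<one> \<in> B\<close> by (metis card_1_singleton_iff is_singletonI' is_singleton_def empty_iff One_nat_def)
    moreover have "A \<subseteq> C" using less.prems(7,8) \<open>A \<subseteq> carrier G\<close> by (metis r_one subset_iff)
    then have "card A \<le> card C" using \<open>finite C\<close> by (rule card_mono[rotated])
    ultimately show ?thesis by simp
  next
    case False
    then obtain a b0 where a: "a \<in> A" "b0 \<in> B" "a \<otimes> b0 \<notin> A" by blast
    have ac: "a \<in> carrier G" using a less.prems by blast
    define A1 where "A1 = A \<union> (\<otimes>) a ` B"
    define B1 where "B1 = {b \<in> B. a \<otimes> b \<in> A}"
    have inj: "inj_on ((\<otimes>) a) B"
      using ac less.prems(5) by (auto intro!: inj_onI simp: subset_iff)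
    have "card ((\<otimes>) a ` B1) = card B1"
      by (rule card_image) (rule inj_on_subset[OF inj], auto simp: B1_def)
    \<comment> \<open>The part of B that is removed is what aB adds to A; inclusion-exclusion for A
      and aB then keeps the total size.\<close>
    moreover have "(\<otimes>) a ` B1 = A \<inter> (\<otimes>) a ` B" unfolding B1_def by auto
    ultimately have sum: "card A1 + card B1 = card A + card B"
      using card_Un_Int[of A "(\<otimes>) a ` B"] card_image[OF inj] less.prems
      unfolding A1_def by simp
    have "card A1 + card B1 \<le> card C + 1"
    proof (rule less.hyps)
      \<comment> \<open>The element \<open>b0\<close> is lost, since \<open>a \<otimes> b0\<close>
        lies outside A.\<close>
      show "card B1 < card B"
        using a less.prems by (intro psubset_card_mono) (auto simp: B1_def)
      show "\<one> \<in> B1" using a ac less.prems unfolding B1_def by auto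
    next
      fix u v assume u: "u \<in> A1" and v: "v \<in> B1"
      have vc: "v \<in> carrier G" "v \<in> B" "a \<otimes> v \<in> A" using v less.prems unfolding B1_def by auto
      consider "u \<in> A" | b where "b \<in> B" "u = a \<otimes> b" using u unfolding A1_def by auto
      then have "u \<otimes> v \<in> C \<and> (u \<otimes> v = \<one> \<longrightarrow> u = \<one> \<and> v = \<one>)"
      proof (cases)
        case 1
        then show ?thesis using less.prems vc by blast
      next
        case (2 b)
        have bc: "b \<in> carrier G" using 2 less.prems by blast
        \<comment> \<open>Commutativity regroups (ab)v as (av)b, and av is in A by the choice of
          \<open>B1\<close>; so the product is again one of an element of A and an element of
          B.\<close>
        have eq: "u \<otimes> v = (a \<otimes> v) \<otimes> b" using ac bc vc 2 by (simp add: m_ac)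
        moreover have "u = \<one> \<and> v = \<one>" if "u \<otimes> v = \<one>"
        proof -
          \<comment> \<open>Unique factorisation is used twice: on (av)b = 1, and then on av = 1,
            which gives a = v = 1.\<close>
          have "a \<otimes> v = \<one>" "b = \<one>"
            using that eq less.prems(9)[OF vc(3) 2(1)] by auto
          then show ?thesis using less.prems(9)[OF a(1) vc(2)] 2 ac by auto
        qed
        ultimately show ?thesis using less.prems(8) 2 vc by auto
      qed
      then show "u \<otimes> v \<in> C" and "u \<otimes> v = \<one> \<Longrightarrow> u = \<one> \<and> v = \<one>" by auto
    qed (use less.prems ac in \<open>auto simp: A1_def B1_def\<close>)
    then show ?thesis using sum by simp
  qed
qed

text \<open>Dividing A by x, B by y and C by xy preserves cardinalities and moves the uniquely
  represented element to 1, where \<open>scherk_unique_one\<close> applies.\<close>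

theorem (in comm_group) scherk:
  assumes fin: "finite A" "finite B" "finite C" and sub: "A \<subseteq> carrier G" "B \<subseteq> carrier G"
    and xy: "x \<in> A" "y \<in> B"
    and prod: "A <#> B \<subseteq> C"
    and unique: "\<And>a b. a \<in> A \<Longrightarrow> b \<in> B \<Longrightarrow> a \<otimes> b = x \<otimes> y \<Longrightarrow> a = x \<and> b = y"
  shows "card A + card B \<le> card C + 1"
proof -
  have c: "x \<in> carrier G" "y \<in> carrier G" using xy sub by auto
  \<comment> \<open>The set C may contain elements outside the group; translation is known to be
    injective only on the carrier.\<close>
  define C' where "C' = C \<inter> carrier G"
  have "C' \<subseteq> carrier G" by (simp add: C'_def)
  have card_tr: "card ((\<otimes>) (inv z) ` S) = card S" if "z \<in> carrier G" "S \<subseteq> carrier G" for z S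
    using that by (intro card_image inj_onI) (auto simp: subset_iff)
  have key: "(inv x \<otimes> u) \<otimes> (inv y \<otimes> v) = inv (x \<otimes> y) \<otimes> (u \<otimes> v)"
    if "u \<in> A" "v \<in> B" for u v
  proof -
    have "u \<in> carrier G" "v \<in> carrier G" using that sub by auto
    then show ?thesis using c by (simp add: inv_mult m_ac)
  qed
  have "card ((\<otimes>) (inv x) ` A) + card ((\<otimes>) (inv y) ` B) \<le> card ((\<otimes>) (inv (x \<otimes> y)) ` C') + 1"
  proof (rule scherk_unique_one)
    fix a b assume "a \<in> (\<otimes>) (inv x) ` A" "b \<in> (\<otimes>) (inv y) ` B"
    then obtain u v where uv: "u \<in> A" "v \<in> B" "a = inv x \<otimes> u" "b = inv y \<otimes> v" by auto
    have uvc: "u \<in> carrier G" "v \<in> carrier G" using uv sub by auto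
    have "u \<otimes> v \<in> C'" using uv uvc prod unfolding C'_def set_mult_def by auto
    then show "a \<otimes> b \<in> (\<otimes>) (inv (x \<otimes> y)) ` C'" using key uv by auto
    assume "a \<otimes> b = \<one>"
    then have "inv (x \<otimes> y) \<otimes> (u \<otimes> v) = \<one>" using key uv by simp
    then have "u \<otimes> v = x \<otimes> y"
      using uvc c by (metis inv_closed inv_equality inv_inv m_closed inv_comm)
    then have "u = x" "v = y" using unique uv by auto
    then show "a = \<one> \<and> b = \<one>" using uv c by simp
  next
    show "\<one> \<in> (\<otimes>) (inv x) ` A" "\<one> \<in> (\<otimes>) (inv y) ` B"
      using c xy by (metis l_inv imageI)+
  qed (use fin sub c in \<open>auto simp: C'_def\<close>)
  then have "card A + card B \<le> card C' + 1"
    using card_tr c sub \<open>C' \<subseteq> carrier G\<close> by simp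
  also have "card C' \<le> card C" using fin unfolding C'_def by (simp add: card_mono)
  finally show ?thesis by simp
qed

section \<open>The corner inequality for groups\<close>

text \<open>Consecutive members of a group flag differ by one element; this is the source of unique
  factorisation at a corner.\<close>

lemma card_Suc_diff_singleton:
  assumes "finite T" "S \<subseteq> T" "card T = Suc (card S)" "x \<in> T - S" "y \<in> T - S"
  shows "x = y"
proof -
  have "card (T - S) = 1" using assms by (simp add: card_Diff_subset finite_subset)
  then show ?thesis using assms(4,5) by (metis card_1_singletonE singletonD)
qed

lemma group_flag_corner:
  assumes "comm_group G" "finite (carrier G)" and flag: "group_flag G n F"
    and corner: "is_corner n (group_flag_type G n F) i j"
  shows "group_flag_type G n F i j \<ge> i + j"
proof -
  interpret comm_group G by fact
  have chain: "F i \<subseteq> F (Suc i)" if "Suc i < n" for i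
    using flag that unfolding group_flag_def by blast
  have sub: "F i \<subseteq> carrier G" and card: "card (F i) = Suc i" and fin: "finite (F i)" if "i < n" for i
    using flag that assms(2) finite_subset[of "F i"] unfolding group_flag_def by auto
  have top: "F i <#>\<^bsub>G\<^esub> F j \<subseteq> F (n - 1)" if "i < n" "j < n" for i j
    using flag sub[OF that(1)] sub[OF that(2)] set_mult_closed unfolding group_flag_def by metis
  obtain i' j' k where ijk: "i = Suc i'" "j = Suc j'" "group_flag_type G n F i j = Suc k"
    "Suc i' < n" "Suc j' < n" "Suc k < n"
    and prod: "F i <#>\<^bsub>G\<^esub> F j \<subseteq> F (Suc k)" "\<not> F i <#>\<^bsub>G\<^esub> F j \<subseteq> F k"
    "F i' <#>\<^bsub>G\<^esub> F j \<subseteq> F k" "F i <#>\<^bsub>G\<^esub> F j' \<subseteq> F k"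
    using corner_flag_typeE[OF corner[unfolded group_flag_type_def] chain top]
    unfolding group_flag_type_def by metis
  obtain x y where xy: "x \<in> F i" "y \<in> F j" "x \<otimes>\<^bsub>G\<^esub> y \<notin> F k"
    using prod(2) unfolding set_mult_def by auto
  \<comment> \<open>If either factor came from the previous member of the flag, the product would
    lie in \<open>F k\<close>.\<close>
  have new: "u \<in> F i - F i'" "v \<in> F j - F j'"
    if "u \<in> F i" "v \<in> F j" "u \<otimes>\<^bsub>G\<^esub> v \<notin> F k" for u v
    using that prod(3,4) unfolding set_mult_def by blast+
  \<comment> \<open>The sizes are i + 1, j + 1 and k + 2, so the bound reads i + j \<le> k + 1, the
    corner value.\<close>
  have "card (F i) + card (F j) \<le> card (F (Suc k)) + 1"
  proof (rule scherk[OF _ _ _ _ _ xy(1,2) prod(1)])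
    fix u v assume uv: "u \<in> F i" "v \<in> F j" "u \<otimes>\<^bsub>G\<^esub> v = x \<otimes>\<^bsub>G\<^esub> y"
    have "u = x"
      by (rule card_Suc_diff_singleton[of "F i" "F i'"])
        (use ijk uv xy new(1) fin card chain[of i'] in auto)
    moreover have "v = y"
      by (rule card_Suc_diff_singleton[of "F j" "F j'"])
        (use ijk uv xy new(2) fin card chain[of j'] in auto)
    ultimately show "u = x \<and> v = y" ..
  qed (use ijk fin sub in auto)
  then show ?thesis using ijk card by simp
qed

section \<open>Dimensions of subspaces and of their multiples\<close>

lemma (in ring) dimension_subspace:
  assumes K: "subfield K R" and E: "dimension n K E" and U: "dimension m K U" and "U \<subseteq> E"
  shows "m \<le> n" and "m = n \<Longrightarrow> U = E"
proof -
  obtain Us where Us: "independent K Us" "length Us = m" "Span K Us = U" "set Us \<subseteq> carrier R"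
    using exists_base[OF K U] by blast
  have "set Us \<subseteq> E" using Span_base_incl[OF K Us(4)] Us(3) \<open>U \<subseteq> E\<close> by simp
  then show "m \<le> n" "m = n \<Longrightarrow> U = E"
    using independent_length_le_dimension[OF K E Us(1)]
      independent_length_eq_dimension[OF K E Us(1)] Us by auto
qed

text \<open>Linear counterpart of the one-element difference: adding the line through x to U already
  reaches the full dimension inside E.\<close>

lemma (in ring) dimension_Suc_eq_line_extension:
  assumes K: "subfield K R" and E: "dimension (Suc n) K E" and U: "dimension n K U" and "U \<subseteq> E"
    and x: "x \<in> E" "x \<notin> U"
  shows "E = line_extension K x U"
proof -
  note E_props = space_subgroup_props[OF K E]
  have "dimension (Suc n) K (line_extension K x U)"
    using Suc_dim[of x U n K] x U E_props(1) by blast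
  moreover have "line_extension K x U \<subseteq> E"
    using E_props(3,5) x \<open>U \<subseteq> E\<close> by (auto simp: line_extension_mem_iff subset_iff)
  ultimately show ?thesis using dimension_subspace(2)[OF K E] by blast
qed

lemma (in cring) smult_image_line_extension:
  assumes "K \<subseteq> carrier R" "E \<subseteq> carrier R" "a \<in> carrier R" "v \<in> carrier R"
  shows "(\<otimes>) a ` line_extension K v E = line_extension K (a \<otimes> v) ((\<otimes>) a ` E)"
proof (rule Set.set_eqI)
  fix u
  have eq: "a \<otimes> (k \<otimes> v \<oplus> e) = k \<otimes> (a \<otimes> v) \<oplus> a \<otimes> e" if "k \<in> K" "e \<in> E" for k e
  proof -
    have "k \<in> carrier R" "e \<in> carrier R" using that assms by auto
    then show ?thesis using assms(3,4) by (simp add: r_distr m_lcomm)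
  qed
  have "u \<in> (\<otimes>) a ` line_extension K v E \<longleftrightarrow> (\<exists>k\<in>K. \<exists>e\<in>E. u = a \<otimes> (k \<otimes> v \<oplus> e))"
    unfolding image_iff Bex_def line_extension_mem_iff by blast
  also have "\<dots> \<longleftrightarrow> u \<in> line_extension K (a \<otimes> v) ((\<otimes>) a ` E)"
    by (simp add: line_extension_mem_iff eq cong: bex_cong)
  finally show "u \<in> (\<otimes>) a ` line_extension K v E \<longleftrightarrow>
      u \<in> line_extension K (a \<otimes> v) ((\<otimes>) a ` E)" .
qed

text \<open>Multiplication by a nonzero a is linear and injective. The induction peels off one line
  at a time; cancellation keeps \<open>a \<otimes> v\<close> outside the image of
  \<open>E'\<close>.\<close>

lemma (in domain) dimension_smult_image:
  assumes K: "subfield K R" and a: "a \<in> carrier R" "a \<noteq> \<zero>" and E: "dimension n K E"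
  shows "dimension n K ((\<otimes>) a ` E)"
  using E
proof (induction n arbitrary: E)
  case 0
  then show ?case using dimension_zero[OF K] a by force
next
  case (Suc n)
  from dimension_backwards[OF K Suc.prems] obtain v E'
    where v: "v \<in> carrier R" "dimension n K E'" "v \<notin> E'" "E = line_extension K v E'" by blast
  have E': "E' \<subseteq> carrier R" using space_subgroup_props(1)[OF K v(2)] .
  have "a \<otimes> v \<notin> (\<otimes>) a ` E'" using a v E' by (auto simp: m_lcancel subset_iff)
  then show ?case
    using Suc_dim[OF _ _ Suc.IH[OF v(2)]] a v smult_image_line_extension[OF subfieldE(3)[OF K] E']
    by simp
qed

lemma (in field) inv_nonzero:
  assumes "x \<in> carrier R" "x \<noteq> \<zero>"
  shows "inv x \<in> carrier R" "inv x \<otimes> x = \<one>" "inv x \<noteq> \<zero>"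
proof -
  show inv: "inv x \<in> carrier R" "inv x \<otimes> x = \<one>" using assms by (simp_all add: field_Units)
  show "inv x \<noteq> \<zero>" using inv(2) assms(1) by (metis l_null one_not_zero)
qed

section \<open>The linear analogue of Scherk's theorem\<close>

text \<open>
  The linear counterpart of a unique factorisation of \<open>1\<close> is a functional that is multiplicative
  on \<open>A \<times> B\<close>; this property survives the linear transform to \<open>A + aB\<close> and \<open>B \<inter> a\<inverse>A\<close>.
\<close>

lemma (in field) linear_scherk_multiplicative:
  assumes K: "subfield K R"
    and dims: "dimension p K A" "dimension q K B" and V: "dimension d K V"
    and one: "\<one> \<in> A" "\<one> \<in> B"
    and prod: "\<And>a b. a \<in> A \<Longrightarrow> b \<in> B \<Longrightarrow> a \<otimes> b \<in> V"
    and \<phi>_in: "\<And>u. u \<in> V \<Longrightarrow> \<phi> u \<in> K"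
    and \<phi>_add: "\<And>u v. u \<in> V \<Longrightarrow> v \<in> V \<Longrightarrow> \<phi> (u \<oplus> v) = \<phi> u \<oplus> \<phi> v"
    and \<phi>_K: "\<And>c. c \<in> K \<Longrightarrow> \<phi> c = c"
    and mult: "\<And>a b. a \<in> A \<Longrightarrow> b \<in> B \<Longrightarrow> \<phi> (a \<otimes> b) = \<phi> a \<otimes> \<phi> b"
  shows "p + q \<le> d + 1"
  using dims one prod mult
proof (induction q arbitrary: p A B rule: less_induct)
  case (less q)
  note prod = less.prems(5) and mult = less.prems(6)
  note A = space_subgroup_props[OF K less.prems(1)]
  note B = space_subgroup_props[OF K less.prems(2)]
  have Kc: "K \<subseteq> carrier R" using subfieldE(3)[OF K] .
  have AV: "A \<subseteq> V" using prod[OF _ less.prems(4)] A(1) by (metis r_one subset_iff)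
  have BV: "B \<subseteq> V" using prod[OF less.prems(3)] B(1) by (metis l_one subset_iff)
  have \<phi>c: "\<phi> u \<in> carrier R" if "u \<in> V" for u using \<phi>_in[OF that] Kc by blast
  show ?case
  proof (cases "\<forall>a\<in>A. \<forall>b\<in>B. a \<otimes> b \<in> A")
    case True
    \<comment> \<open>A nonzero b would give bA = A by dimension, so 1 = ba for some a in A.
      Multiplicativity then gives 1 = \<phi>(a)\<phi>(b) = 0.\<close>
    have ker: "b = \<zero>" if b: "b \<in> B" "\<phi> b = \<zero>" for b
    proof (rule ccontr)
      assume "b \<noteq> \<zero>"
      have bc: "b \<in> carrier R" using b B(1) by blast
      have "(\<otimes>) b ` A \<subseteq> A" using True b A(1) bc by (auto simp: m_comm subset_iff)
      then have "(\<otimes>) b ` A = A"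
        using dimension_subspace(2)[OF K less.prems(1)]
          dimension_smult_image[OF K bc \<open>b \<noteq> \<zero>\<close> less.prems(1)] by blast
      then obtain a where a: "a \<in> A" "b \<otimes> a = \<one>" using less.prems(3) by force
      then have "\<phi> (a \<otimes> b) = \<one>" using \<phi>_K[OF subring_props(3)[OF K]] A(1) bc m_comm by force
      moreover have "\<phi> (a \<otimes> b) = \<zero>" using mult[OF a(1) b(1)] b \<phi>c a AV by auto
      ultimately show False by simp
    qed
    \<comment> \<open>Since 1 is in B, so is the scalar \<phi>(b). The difference b - \<phi>(b) is
      in the kernel of \<phi>, hence zero. So B is contained in K.\<close>
    have "b \<in> K" if b: "b \<in> B" for b
    proof -
      have c: "\<phi> b \<in> K" "\<ominus> \<phi> b \<in> K"
        using \<phi>_in b BV subring_props(5)[OF K] by blast+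
      have cc: "\<phi> b \<in> carrier R" "b \<in> carrier R" using c Kc b B(1) by auto
      have cB: "\<ominus> \<phi> b \<in> B" using B(5)[OF c(2) less.prems(4)] cc by simp
      have "\<phi> (b \<oplus> \<ominus> \<phi> b) = \<phi> b \<oplus> \<ominus> \<phi> b"
        using \<phi>_add[of b "\<ominus> \<phi> b"] \<phi>_K[OF c(2)] b cB BV by auto
      then have "b \<oplus> \<ominus> \<phi> b = \<zero>" using ker[OF B(3)[OF b cB]] cc by (simp add: r_neg)
      then have "b = \<phi> b" using cc by (simp add: minus_eq[symmetric])
      then show ?thesis using c by simp
    qed
    then have "q \<le> 1"
      using dimension_subspace(1)[OF K dimension_one[OF K] less.prems(2)] by blast
    then show ?thesis using dimension_subspace(1)[OF K V less.prems(1) AV] by simp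
  next
    case False
    then obtain a b0 where a: "a \<in> A" "b0 \<in> B" "a \<otimes> b0 \<notin> A" by blast
    have ac: "a \<in> carrier R" and b0c: "b0 \<in> carrier R" using a A(1) B(1) by auto
    \<comment> \<open>For a = 0 the product \<open>a \<otimes> b0\<close> would be 0, which lies in
      A.\<close>
    have a0: "a \<noteq> \<zero>" using a b0c A(2) by auto
    define aB where "aB = (\<otimes>) a ` B"
    define A1 where "A1 = A <+>\<^bsub>R\<^esub> aB"
    define B1 where "B1 = {b \<in> B. a \<otimes> b \<in> A}"
    have aB: "dimension q K aB"
      unfolding aB_def by (rule dimension_smult_image[OF K ac a0 less.prems(2)])
    have fin: "finite_dimension K A" "finite_dimension K aB"
      using finite_dimensionI less.prems(1) aB by blast+
    have "finite_dimension K (A \<inter> aB)"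
      by (rule subalbegra_incl_imp_finite_dimension[OF K fin(1) subalgebra_inter])
        (use finite_dimension_imp_subalgebra[OF K] fin in blast)+
    then obtain k where k: "dimension k K (A \<inter> aB)" unfolding finite_dimension_def ..
    \<comment> \<open>Identifying \<open>B1\<close> as a multiple of the intersection of A and aB
      shows that it is a subspace and gives its dimension.\<close>
    have "(\<otimes>) (inv a) ` (A \<inter> aB) = B1"
    proof -
      have "A \<inter> aB = (\<otimes>) a ` B1" unfolding aB_def B1_def by auto
      moreover have "inv a \<otimes> (a \<otimes> b) = b" if "b \<in> B1" for b
      proof -
        have "b \<in> carrier R" using that B(1) unfolding B1_def by auto
        then show ?thesis using ac inv_nonzero[OF ac a0] by (simp add: m_assoc[symmetric])
      qed
      ultimately show ?thesis by (force simp: image_image)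
    qed
    then have dimB1: "dimension k K B1"
      using dimension_smult_image[OF K inv_nonzero(1,3)[OF ac a0] k] by simp
    have dimA1: "dimension (p + q - k) K A1"
      unfolding A1_def by (rule dimension_sum_space[OF K less.prems(1) aB k])
    \<comment> \<open>Subtraction on naturals truncates; this bound makes
      \<open>(p + q - k) + k\<close> equal to \<open>p + q\<close>, so the transform keeps the total
      dimension.\<close>
    have "k \<le> p" using dimension_subspace(1)[OF K less.prems(1) k] by simp
    have "B1 \<subseteq> B" "B1 \<noteq> B" using a unfolding B1_def by auto
    \<comment> \<open>Equal dimensions would force \<open>B1 = B\<close>, although \<open>b0\<close>
      is missing from \<open>B1\<close>.\<close>
    then have "k < q"
      using dimension_subspace[OF K less.prems(2) dimB1] by (metis le_neq_implies_less)
    have "(p + q - k) + k \<le> d + 1"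
    proof (rule less.IH[OF \<open>k < q\<close> dimA1 dimB1])
      have "\<zero> \<in> aB" using space_subgroup_props(2)[OF K aB] .
      then show "\<one> \<in> A1" using less.prems(3) unfolding A1_def set_add_def' by force
      show "\<one> \<in> B1" using less.prems(4) a ac unfolding B1_def by simp
    next
      fix u v assume u: "u \<in> A1" and v: "v \<in> B1"
      then obtain a' b where ab: "a' \<in> A" "b \<in> B" "u = a' \<oplus> a \<otimes> b"
        unfolding A1_def aB_def set_add_def' by auto
      have vB: "v \<in> B" "a \<otimes> v \<in> A" using v unfolding B1_def by auto
      have c: "a' \<in> carrier R" "b \<in> carrier R" "v \<in> carrier R" using ab vB A(1) B(1) by auto
      \<comment> \<open>As in the group case, (ab)v is regrouped as (av)b with av in A, so both
        summands are products from A and B, where \<phi> is multiplicative.\<close>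
      have uv: "u \<otimes> v = a' \<otimes> v \<oplus> (a \<otimes> v) \<otimes> b"
        using ab c ac by (simp add: l_distr r_distr m_ac)
      have V1: "a' \<otimes> v \<in> V" "(a \<otimes> v) \<otimes> b \<in> V" "a' \<in> V" "a \<otimes> b \<in> V"
        using prod ab vB a AV by auto
      then show "u \<otimes> v \<in> V" using uv space_subgroup_props(3)[OF K V] by simp
      have \<phi>s: "\<phi> a' \<in> carrier R" "\<phi> a \<in> carrier R" "\<phi> b \<in> carrier R" "\<phi> v \<in> carrier R"
        using \<phi>c ab a vB AV BV by auto
      have "\<phi> (u \<otimes> v) = \<phi> a' \<otimes> \<phi> v \<oplus> (\<phi> a \<otimes> \<phi> v) \<otimes> \<phi> b"
        using uv V1 \<phi>_add mult ab vB a by simp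
      also have "\<dots> = (\<phi> a' \<oplus> \<phi> a \<otimes> \<phi> b) \<otimes> \<phi> v"
        using \<phi>s by (simp add: l_distr r_distr m_ac)
      also have "\<phi> a' \<oplus> \<phi> a \<otimes> \<phi> b = \<phi> u"
        using ab V1 \<phi>_add mult a by simp
      finally show "\<phi> (u \<otimes> v) = \<phi> u \<otimes> \<phi> v" .
    qed
    then show ?thesis using \<open>k \<le> p\<close> by simp
  qed
qed

text \<open>\<phi> is the projection of K + W onto K along W. It is well defined because a nonzero
  scalar in W could be inverted to put 1 into W.\<close>

lemma (in field) line_extension_one_coordinate:
  assumes K: "subfield K R" and W: "dimension d K W" and "\<one> \<notin> W"
  obtains \<phi> where "\<And>c w. c \<in> K \<Longrightarrow> w \<in> W \<Longrightarrow> \<phi> (c \<oplus> w) = c"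
proof -
  note W_props = space_subgroup_props[OF K W]
  have Kc: "K \<subseteq> carrier R" using subfieldE(3)[OF K] .
  have uniq: "c = c'" if "c \<in> K" "c' \<in> K" "w \<in> W" "w' \<in> W" "c \<oplus> w = c' \<oplus> w'" for c c' w w'
  proof (rule ccontr)
    assume "c \<noteq> c'"
    have cc: "c \<in> carrier R" "c' \<in> carrier R" "w \<in> carrier R" "w' \<in> carrier R"
      using that Kc W_props(1) by auto
    define e where "e = c \<ominus> c'"
    have eK: "e \<in> K - {\<zero>}"
      using that \<open>c \<noteq> c'\<close> cc subring_props(5,7)[OF K] unfolding e_def
      by (metis Diff_iff a_minus_def r_right_minus_eq singletonD)
    have "e = w' \<ominus> w"
    proof -
      have "c = (c \<oplus> w) \<ominus> w" using cc by algebra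
      also have "\<dots> = (c' \<oplus> w') \<ominus> w" using that by simp
      finally show ?thesis unfolding e_def using cc by algebra
    qed
    then have "e \<in> W" using that W_props(3,4) unfolding minus_eq by simp
    then have "inv e \<otimes> e \<in> W" using W_props(5) subfield_m_inv(1)[OF K eK] by blast
    then show False using subfield_m_inv(3)[OF K eK] \<open>\<one> \<notin> W\<close> by simp
  qed
  have "(SOME c. c \<in> K \<and> (\<exists>w'\<in>W. c0 \<oplus> w = c \<oplus> w')) = c0" if "c0 \<in> K" "w \<in> W" for c0 w
    by (rule some_equality) (use that uniq in blast)+
  then show thesis by (rule that[of "\<lambda>u. SOME c. c \<in> K \<and> (\<exists>w'\<in>W. u = c \<oplus> w')"])
qed

text \<open>The case x = y = 1. The coordinate along 1 modulo W is multiplicative on (K + A)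
  \<times> (K + B), because every term of a product other than the scalar one falls into W.\<close>

lemma (in field) linear_scherk_one:
  assumes K: "subfield K R"
    and dims: "dimension m K A" "dimension n K B" and W: "dimension d K W"
    and one: "\<one> \<notin> W"
    and AB: "\<And>a b. a \<in> A \<Longrightarrow> b \<in> line_extension K \<one> B \<Longrightarrow> a \<otimes> b \<in> W"
    and BA: "\<And>a b. a \<in> line_extension K \<one> A \<Longrightarrow> b \<in> B \<Longrightarrow> a \<otimes> b \<in> W"
  shows "m + n \<le> d"
proof -
  note W_props = space_subgroup_props[OF K W]
  have Kc: "K \<subseteq> carrier R" using subfieldE(3)[OF K] .
  have ext: "u \<in> line_extension K \<one> E \<longleftrightarrow> (\<exists>c\<in>K. \<exists>e\<in>E. u = c \<oplus> e)" for u E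
    using Kc by (force simp: line_extension_mem_iff subset_iff)
  have K01: "\<zero> \<in> K" "\<one> \<in> K" using subring_props(2,3)[OF K] by auto
  have one_ext: "\<one> \<in> line_extension K \<one> E" if "dimension e K E" for e E
    unfolding ext using K01 space_subgroup_props(2)[OF K that] by force
  have AW: "A \<subseteq> W" using AB[OF _ one_ext[OF dims(2)]] space_subgroup_props(1)[OF K dims(1)]
    by (metis r_one subset_iff)
  have BW: "B \<subseteq> W" using BA[OF one_ext[OF dims(1)]] space_subgroup_props(1)[OF K dims(2)]
    by (metis l_one subset_iff)
  obtain \<phi> where \<phi>: "\<And>c w. c \<in> K \<Longrightarrow> w \<in> W \<Longrightarrow> \<phi> (c \<oplus> w) = c"
    using line_extension_one_coordinate[OF K W one] by blast
  have prod: "\<exists>w\<in>W. (c \<oplus> a) \<otimes> (c' \<oplus> b) = c \<otimes> c' \<oplus> w"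
    if "c \<in> K" "c' \<in> K" "a \<in> A" "b \<in> B" for c c' a b
  proof
    have "c' \<oplus> b \<in> line_extension K \<one> B" using that ext by blast
    \<comment> \<open>The first summand lies in W by \<open>AB\<close>, the second because B is
      contained in W.\<close>
    then show "a \<otimes> (c' \<oplus> b) \<oplus> c \<otimes> b \<in> W"
      using that AB W_props(3,5) BW by blast
    have "c \<in> carrier R" "c' \<in> carrier R" "a \<in> carrier R" "b \<in> carrier R"
      using that Kc AW BW W_props(1) by auto
    then show "(c \<oplus> a) \<otimes> (c' \<oplus> b) = c \<otimes> c' \<oplus> (a \<otimes> (c' \<oplus> b) \<oplus> c \<otimes> b)" by algebra
  qed
  have Kprod: "c \<otimes> c' \<in> K" "c \<oplus> c' \<in> K" if "c \<in> K" "c' \<in> K" for c c'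
    using that subring_props(6,7)[OF K] by auto
  \<comment> \<open>Adjoining 1 raises each dimension by one, as 1 lies outside W and therefore
    outside its subspaces A and B.\<close>
  have "Suc m + Suc n \<le> Suc d + 1"
  proof (rule linear_scherk_multiplicative[OF K, where \<phi> = \<phi>])
    show "dimension (Suc m) K (line_extension K \<one> A)" "dimension (Suc n) K (line_extension K \<one> B)"
      "dimension (Suc d) K (line_extension K \<one> W)"
      using Suc_dim[OF one_closed] dims W one AW BW by blast+
    show "\<one> \<in> line_extension K \<one> A" "\<one> \<in> line_extension K \<one> B" using one_ext dims by auto
  next
    fix a b assume "a \<in> line_extension K \<one> A" "b \<in> line_extension K \<one> B"
    then obtain c a' c' b' where *: "c \<in> K" "c' \<in> K" "a' \<in> A" "b' \<in> B" "a = c \<oplus> a'" "b = c' \<oplus> b'"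
      unfolding ext by blast
    obtain w where w: "w \<in> W" "a \<otimes> b = c \<otimes> c' \<oplus> w" using prod * by blast
    show "a \<otimes> b \<in> line_extension K \<one> W" using w Kprod(1) * ext by blast
    have "\<phi> a = c" "\<phi> b = c'" using \<phi> * AW BW by auto
    then show "\<phi> (a \<otimes> b) = \<phi> a \<otimes> \<phi> b" using w \<phi> Kprod(1) * by simp
  next
    fix u v assume "u \<in> line_extension K \<one> W" "v \<in> line_extension K \<one> W"
    then obtain c w c' w' where *: "c \<in> K" "c' \<in> K" "w \<in> W" "w' \<in> W" "u = c \<oplus> w" "v = c' \<oplus> w'"
      unfolding ext by blast
    have "c \<in> carrier R" "c' \<in> carrier R" "w \<in> carrier R" "w' \<in> carrier R"
      using * Kc W_props(1) by auto
    then have "u \<oplus> v = (c \<oplus> c') \<oplus> (w \<oplus> w')" using * by (simp add: a_ac)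
    then show "\<phi> (u \<oplus> v) = \<phi> u \<oplus> \<phi> v" using \<phi> * Kprod(2) W_props(3) by simp
  next
    fix u assume "u \<in> line_extension K \<one> W"
    then show "\<phi> u \<in> K" unfolding ext using \<phi> by auto
  next
    fix c assume "c \<in> K"
    then show "\<phi> c = c" using \<phi>[OF _ W_props(2), of c] Kc by (auto simp: subset_iff)
  qed
  then show ?thesis by simp
qed

text \<open>Scaling A by the inverse of x, B by that of y and W by that of xy preserves dimensions
  and the inclusions, and reduces to x = y = 1.\<close>

theorem (in field) linear_scherk:
  assumes K: "subfield K R"
    and dims: "dimension m K A" "dimension n K B" "dimension d K W"
    and x: "x \<in> carrier R" and y: "y \<in> carrier R" and xy: "x \<otimes> y \<notin> W"
    and AB: "\<And>a b. a \<in> A \<Longrightarrow> b \<in> line_extension K y B \<Longrightarrow> a \<otimes> b \<in> W"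
    and BA: "\<And>a b. a \<in> line_extension K x A \<Longrightarrow> b \<in> B \<Longrightarrow> a \<otimes> b \<in> W"
  shows "m + n \<le> d"
proof -
  have Kc: "K \<subseteq> carrier R" using subfieldE(3)[OF K] .
  note carr = space_subgroup_props(1)[OF K dims(1)] space_subgroup_props(1)[OF K dims(2)]
    space_subgroup_props(1)[OF K dims(3)]
  have nz: "x \<noteq> \<zero>" "y \<noteq> \<zero>" using xy x y space_subgroup_props(2)[OF K dims(3)] by auto
  define x' y' where "x' = inv x" and "y' = inv y"
  have x': "x' \<in> carrier R" "x' \<otimes> x = \<one>" "x' \<noteq> \<zero>"
    using inv_nonzero[OF x nz(1)] unfolding x'_def by auto
  have y': "y' \<in> carrier R" "y' \<otimes> y = \<one>" "y' \<noteq> \<zero>"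
    using inv_nonzero[OF y nz(2)] unfolding y'_def by auto
  let ?z = "x' \<otimes> y'"
  have extA: "line_extension K \<one> ((\<otimes>) x' ` A) = (\<otimes>) x' ` line_extension K x A"
    and extB: "line_extension K \<one> ((\<otimes>) y' ` B) = (\<otimes>) y' ` line_extension K y B"
    using smult_image_line_extension[OF Kc carr(1) x'(1) x]
      smult_image_line_extension[OF Kc carr(2) y'(1) y] x' y' by auto
  have scaled: "(x' \<otimes> a) \<otimes> (y' \<otimes> b) \<in> (\<otimes>) ?z ` W"
    if "a \<in> carrier R" "b \<in> carrier R" "a \<otimes> b \<in> W" for a b
    using that x' y' by (intro image_eqI[of _ _ "a \<otimes> b"]) (auto simp: m_ac)
  have ext_carr: "line_extension K x A \<subseteq> carrier R" "line_extension K y B \<subseteq> carrier R"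
    using line_extension_in_carrier Kc carr x y by auto
  show ?thesis
  proof (rule linear_scherk_one[OF K])
    show "dimension m K ((\<otimes>) x' ` A)" "dimension n K ((\<otimes>) y' ` B)" "dimension d K ((\<otimes>) ?z ` W)"
      using dimension_smult_image[OF K] dims x' y' by (auto simp: integral_iff)
    \<comment> \<open>An element w of W scaled to 1 would be xy itself, which lies outside
      W.\<close>
    show "\<one> \<notin> (\<otimes>) ?z ` W"
    proof
      assume "\<one> \<in> (\<otimes>) ?z ` W"
      then obtain w where w: "w \<in> W" "?z \<otimes> w = \<one>" by auto
      have "w \<in> carrier R" using w carr by auto
      then have "w = (x' \<otimes> x) \<otimes> (y' \<otimes> y) \<otimes> w" using x' y' by simp
      also have "\<dots> = (x \<otimes> y) \<otimes> (?z \<otimes> w)"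
        using \<open>w \<in> carrier R\<close> x y x'(1) y'(1) by (simp add: m_ac)
      finally show False using w x y xy by simp
    qed
  next
    fix a b assume "a \<in> (\<otimes>) x' ` A" "b \<in> line_extension K \<one> ((\<otimes>) y' ` B)"
    then show "a \<otimes> b \<in> (\<otimes>) ?z ` W"
      unfolding extB using AB scaled carr ext_carr by (auto simp: subset_iff)
  next
    fix a b assume "a \<in> line_extension K \<one> ((\<otimes>) x' ` A)" "b \<in> (\<otimes>) y' ` B"
    then show "a \<otimes> b \<in> (\<otimes>) ?z ` W"
      unfolding extA using BA scaled carr ext_carr by (auto simp: subset_iff)
  qed
qed

section \<open>The corner inequality for field extensions\<close>

text \<open>Each member of a field flag is a subspace, so the corner conditions on spans become
  conditions on plain products.\<close>

lemma subspace_span_subset_iff: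
  assumes "subalgebra K V L"
  shows "subspace_span K L S \<subseteq> V \<longleftrightarrow> S \<subseteq> V"
  using assms unfolding subspace_span_def by blast

lemma field_flag_corner:
  assumes "field L" and K: "subfield K L" and flag: "field_flag K L n F"
    and corner: "is_corner n (field_flag_type K L n F) i j"
  shows "field_flag_type K L n F i j \<ge> i + j"
proof -
  interpret field L by fact
  have chain: "F i \<subseteq> F (Suc i)" if "Suc i < n" for i
    using flag that unfolding field_flag_def by blast
  have alg: "subalgebra K (F i) L" and dim: "dimension (Suc i) K (F i)" if "i < n" for i
    using flag that unfolding field_flag_def by auto
  have sub: "F i \<subseteq> carrier L" if "i < n" for i using subalgebra_in_carrier[OF alg[OF that]] .
  have span_iff: "subspace_span K L S \<subseteq> F k \<longleftrightarrow> S \<subseteq> F k" if "k < n" for S k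
    using subspace_span_subset_iff[OF alg[OF that]] .
  have top: "subspace_span K L (F i <#>\<^bsub>L\<^esub> F j) \<subseteq> F (n - 1)" if "i < n" "j < n" for i j
    using flag set_mult_closed[OF sub[OF that(1)] sub[OF that(2)]] span_iff[of "n - 1"] that
    unfolding field_flag_def by auto
  obtain i' j' k where ijk: "i = Suc i'" "j = Suc j'" "field_flag_type K L n F i j = Suc k"
    "Suc i' < n" "Suc j' < n" "Suc k < n"
    and span: "\<not> subspace_span K L (F i <#>\<^bsub>L\<^esub> F j) \<subseteq> F k"
    "subspace_span K L (F i' <#>\<^bsub>L\<^esub> F j) \<subseteq> F k" "subspace_span K L (F i <#>\<^bsub>L\<^esub> F j') \<subseteq> F k"
    using corner_flag_typeE[OF corner[unfolded field_flag_type_def] chain top]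
    unfolding field_flag_type_def by metis
  have prod: "\<not> F i <#>\<^bsub>L\<^esub> F j \<subseteq> F k" "F i' <#>\<^bsub>L\<^esub> F j \<subseteq> F k" "F i <#>\<^bsub>L\<^esub> F j' \<subseteq> F k"
    using span span_iff[of k] ijk by auto
  obtain x y where xy: "x \<in> F i" "y \<in> F j" "x \<otimes>\<^bsub>L\<^esub> y \<notin> F k"
    using prod(1) unfolding set_mult_def by auto
  have new: "x \<notin> F i'" "y \<notin> F j'"
    using xy prod(2,3) unfolding set_mult_def by blast+
  have ext: "F i = line_extension K x (F i')" "F j = line_extension K y (F j')"
    using dimension_Suc_eq_line_extension[OF K dim dim chain] ijk xy new by auto
  \<comment> \<open>The smaller spaces \<open>F i'\<close>, \<open>F j'\<close> and
    \<open>F k\<close> have dimensions i, j and k + 1, so the bound is already i + j \<le> k +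
    1.\<close>
  have "Suc i' + Suc j' \<le> Suc k"
  proof (rule linear_scherk[OF K])
    show "dimension (Suc i') K (F i')" "dimension (Suc j') K (F j')" "dimension (Suc k) K (F k)"
      using dim ijk by auto
    show "x \<in> carrier L" "y \<in> carrier L" using xy sub ijk by auto
    show "x \<otimes>\<^bsub>L\<^esub> y \<notin> F k" by fact
  next
    fix a b
    show "a \<in> F i' \<Longrightarrow> b \<in> line_extension K y (F j') \<Longrightarrow> a \<otimes>\<^bsub>L\<^esub> b \<in> F k"
      and "a \<in> line_extension K x (F i') \<Longrightarrow> b \<in> F j' \<Longrightarrow> a \<otimes>\<^bsub>L\<^esub> b \<in> F k"
      using prod(2,3) unfolding ext[symmetric] set_mult_def by blast+
  qed
  then show ?thesis using ijk by simp
qed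

theorem theorem1p24:
  fixes G :: "('a, 'm) monoid_scheme" and L :: "('b, 'r) ring_scheme"
  shows "(\<forall>n F. comm_group G \<and> finite (carrier G) \<and> order G = n \<and> group_flag G n F \<longrightarrow>
            (\<forall>i j. is_corner n (group_flag_type G n F) i j \<longrightarrow>
               group_flag_type G n F i j \<ge> i + j)) \<and>
         (\<forall>K n F. field L \<and> subfield K L \<and> ring.dimension L n K (carrier L) \<and> field_flag K L n F \<longrightarrow>
            (\<forall>i j. is_corner n (field_flag_type K L n F) i j \<longrightarrow>
               field_flag_type K L n F i j \<ge> i + j))"
  using group_flag_corner field_flag_corner by blast

end
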